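(* Let $N\ge 2$ and $j\ge 2$ be integers, let $u=(1/N,\dots,1/N)$, let $p=(p_1,\dots,p_N)$ be a probability vector with all $p_i>0$ and $p\ne u$, and let $p(\theta)=u+\theta(p-u)$ for $0\le\theta\le 1$. For every $0<z<1$, the map $\theta\mapsto \mathbb E_{p(\theta)}z^{U_j^N}$ is strictly increasing on $[0,1]$. Equivalently, for every $s>0$, the map $\theta\mapsto \mathbb E_{p(\theta)}e^{-sU_j^N}$ is strictly increasing on $[0,1]$. Thus, if $0\le\theta_1<\theta_2\le 1$, then $$U_{j,p(\theta_2)}^N\le_{\rm Lt}U_{j,p(\theta_1)}^N,$$ where $X\le_{\rm Lt}Y$ means $\mathbb E e^{-sX}\ge \mathbb E e^{-sY}$ for all $s>0$.
   Context: Siblings coupon-collector model: for a probability vector $p=(p_1,\dots,p_N)$ with all $p_i>0$, coupons with types in $\{1,\dots,N\}$ are sampled independently with replacement, each having type $i$ with probability $p_i$. The main collector stops at the first time $\tau$ at which all $N$ types have appeared at least once (almost surely finite). Duplicates are passed to the next collector (sibling); if that collector already has that type, the coupon is passed to the next sibling, and so on. $U_j^N$ is the number of empty spaces in the $j$th collector's album at time $\tau$ (the main collector being the first collector); equivalently, $U_j^N$ is the number of coupon types whose total count among the first $\tau$ coupons is less than $j$. $\mathbb E_p$ denotes expectation when the coupon-type law is $p$, and $U_{j,p}^N$ denotes the random variable $U_j^N$ when the coupon-type law is $p$. *)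

theory Defs
  imports "HOL-Probability.Probability"
begin

text \<open>Coupon types are \<open>1, ..., N\<close>. A vector indexed by the types is a function on \<open>nat\<close> of which
  only the values on \<open>{1..N}\<close> matter.\<close>

definition unif :: "nat \<Rightarrow> nat \<Rightarrow> real" where
  "unif N = (\<lambda>i. 1 / real N)"

definition ray :: "nat \<Rightarrow> (nat \<Rightarrow> real) \<Rightarrow> real \<Rightarrow> nat \<Rightarrow> real" where
  "ray N p \<theta> = (\<lambda>i. unif N i + \<theta> * (p i - unif N i))"

text \<open>\<open>embed_pmf\<close> is meaningful only if \<open>p\<close> is nonnegative on \<open>{1..N}\<close> and sums to 1 there.\<close>

definition coupon_law :: "nat \<Rightarrow> (nat \<Rightarrow> real) \<Rightarrow> nat pmf" where
  "coupon_law N p = embed_pmf (\<lambda>i. if i \<in> {1..N} then p i else 0)"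

definition draws :: "nat \<Rightarrow> (nat \<Rightarrow> real) \<Rightarrow> (nat \<Rightarrow> nat) measure" where
  "draws N p = Pi\<^sub>M UNIV (\<lambda>_::nat. measure_pmf (coupon_law N p))"

text \<open>The first \<open>t\<close> coupons of a sequence \<open>\<omega>\<close> are \<open>\<omega> 0, ..., \<omega> (t - 1)\<close>. On the null set where
  some type never appears, the value of \<open>\<tau>\<close> is an irrelevant constant.\<close>

definition \<tau> :: "nat \<Rightarrow> (nat \<Rightarrow> nat) \<Rightarrow> nat" where
  "\<tau> N \<omega> = (LEAST t. {1..N} \<subseteq> \<omega> ` {..<t})"

text \<open>\<open>album \<omega> t j\<close> is the content of the album of the \<open>j\<close>-th collector after \<open>t\<close> coupons: each
  coupon goes to the first collector (numbered from 1) whose album lacks its type.\<close>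

primrec album :: "(nat \<Rightarrow> nat) \<Rightarrow> nat \<Rightarrow> nat \<Rightarrow> nat set" where
  "album \<omega> 0 = (\<lambda>_. {})"
| "album \<omega> (Suc t) =
    (let A = album \<omega> t; k = (LEAST k. 1 \<le> k \<and> \<omega> t \<notin> A k)
     in A(k := insert (\<omega> t) (A k)))"

definition U :: "nat \<Rightarrow> nat \<Rightarrow> (nat \<Rightarrow> nat) \<Rightarrow> nat" where
  "U N j \<omega> = card ({1..N} - album \<omega> (\<tau> N \<omega>) j)"

lemma album_eq:
  assumes "1 \<le> j"
  shows "album \<omega> t j = {i. j \<le> card {k. k < t \<and> \<omega> k = i}}"
  using assms
proof (induction t arbitrary: j)
  case 0
  then show ?case by simp
next
  case (Suc t)
  define c where "c = card {k. k < t \<and> \<omega> k = \<omega> t}"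
  have L: "(LEAST k. 1 \<le> k \<and> \<omega> t \<notin> album \<omega> t k) = Suc c"
  proof (rule Least_equality)
    show "1 \<le> Suc c \<and> \<omega> t \<notin> album \<omega> t (Suc c)"
      using Suc.IH[of "Suc c"] by (simp add: c_def)
    show "Suc c \<le> y" if "1 \<le> y \<and> \<omega> t \<notin> album \<omega> t y" for y
      using that Suc.IH[of y] by (simp add: c_def)
  qed
  have S: "card {k. k < Suc t \<and> \<omega> k = i} =
      card {k. k < t \<and> \<omega> k = i} + (if \<omega> t = i then 1 else 0)" for i
  proof -
    have "{k. k < Suc t \<and> \<omega> k = i} =
        (if \<omega> t = i then insert t {k. k < t \<and> \<omega> k = i} else {k. k < t \<and> \<omega> k = i})"
      by (auto simp: less_Suc_eq)
    then show ?thesis by simp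
  qed
  show ?case
    using Suc.IH[OF Suc.prems] by (auto simp: Let_def L[unfolded One_nat_def] S c_def[symmetric] split: if_splits)
qed

lemma U_eq:
  assumes "1 \<le> j"
  shows "U N j \<omega> = card {i \<in> {1..N}. card {k. k < \<tau> N \<omega> \<and> \<omega> k = i} < j}"
  unfolding U_def album_eq[OF assms] by (rule arg_cong[of _ _ card]) auto

definition laplace_le :: "'a measure \<Rightarrow> ('a \<Rightarrow> real) \<Rightarrow> 'b measure \<Rightarrow> ('b \<Rightarrow> real) \<Rightarrow> bool" where
  "laplace_le M X M' Y \<longleftrightarrow>
    (\<forall>s>0. (LINT \<omega>|M. exp (- s * X \<omega>)) \<ge> (LINT \<omega>|M'. exp (- s * Y \<omega>)))"

end

theory Submission
  imports Defs "HOL-Real_Asymp.Real_Asymp"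
begin

text \<open>
  Let the coupons arrive at the times of a Poisson process of rate 1. The counts of the types are
  then independent Poisson processes with rates \<open>q i\<close>, and conditioning on the time \<open>t\<close> and the
  type \<open>i\<close> of the coupon that completes the first album gives
  \<open>E z^U = z * (\<integral>t\<ge>0. (\<Sum>i. q i * exp (- q i * t) * (\<Prod>k\<noteq>i. g (q k * t))))\<close>.
  Here \<open>g x\<close> is the expectation of \<open>0\<close>, \<open>z\<close> or \<open>1\<close> according as a Poisson variable of mean
  \<open>x\<close> is \<open>0\<close>, lies in \<open>{1..<j}\<close>, or is at least \<open>j\<close>; the factor \<open>z\<close> in front stands for the
  last type, which has count \<open>1 < j\<close>. The process itself does not have to be constructed: summing
  over the number \<open>n\<close> of coupons before the last one and using \<open>n! = (\<integral>t\<ge>0. t^n * exp (-t))\<close>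
  turns the sum into the integral, because the \<open>n\<close>-th term is \<open>n!\<close> times the \<open>n\<close>-th coefficient
  of a product of exponential generating functions (\<open>nn_integral_counts_then_coupon\<close>,
  \<open>nn_integral_power_U\<close>).

  Along the ray \<open>q \<theta> i = u + \<theta> * d i\<close> the \<open>\<theta>\<close>-derivative of the integrand is a total
  \<open>t\<close>-derivative plus a source term (\<open>rate'_eq\<close>). The total derivative is that of
  \<open>flux \<theta> t = (\<Sum>l. t * d l * exp (- q l * t) * (\<Prod>k\<noteq>l. g (q k * t)))\<close>, which arises
  from the integrand when the factor \<open>q l\<close> of each term is replaced by \<open>t * d l\<close>; it vanishes at
  \<open>0\<close> and at infinity, so that only the source matters. After symmetrisation in two types \<open>l\<close> and \<open>m\<close>, the source is a sum of positive
  multiples of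
  \<open>(d m - d l) * (exp (- x l) * g' (x m) - exp (- x m) * g' (x l))\<close> with \<open>x k = q k * t\<close>. Since
  \<open>g' x / exp (- x) = z + (1 - z) * x ^ (j - 1) / fact (j - 1)\<close> is strictly increasing for
  \<open>j \<ge> 2\<close>, and the \<open>x k\<close> are ordered as the \<open>d k\<close> when \<open>\<theta> > 0\<close>, every term with
  \<open>d l \<noteq> d m\<close> is positive (\<open>cell_gf'_cross\<close>, \<open>source_pos\<close>). Such a pair exists because the
  direction \<open>d = p - u\<close> sums to \<open>0\<close> and does not vanish.

  The derivative is taken on bounded time windows only (\<open>truncated_DERIV\<close>); the flux through the
  far end decays uniformly in \<open>\<theta>\<close> and disappears when the window grows (\<open>limit_increment\<close>).
  Laplace transforms are the case \<open>z = exp (- s)\<close>.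
\<close>

section \<open>One Poisson cell\<close>

text \<open>
  The expectation of \<open>final_weight\<close> below over a Poisson count of mean \<open>x\<close>, for a type other than
  the last one. It is \<open>1\<close> minus what the weight \<open>1\<close> would count too much: \<open>1 - z\<close> for each count
  below \<open>j\<close>, and another \<open>z\<close> for the count \<open>0\<close>.
\<close>
definition cell_gf :: "real \<Rightarrow> nat \<Rightarrow> real \<Rightarrow> real" where
  "cell_gf z j x = 1 - z * exp (-x) - (1 - z) * (\<Sum>m<j. exp (-x) * x ^ m / fact m)"

definition cell_gf' :: "real \<Rightarrow> nat \<Rightarrow> real \<Rightarrow> real" where
  "cell_gf' z j x = z * exp (-x) + (1 - z) * (exp (-x) * x ^ (j - 1) / fact (j - 1))"

text \<open>
  The derivatives of the single Poisson weights telescope.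
\<close>
lemma poisson_cdf_DERIV:
  "((\<lambda>x::real. \<Sum>m<Suc n. exp (-x) * x ^ m / fact m) has_field_derivative
     - (exp (-x) * x ^ n / fact n)) (at x)"
proof (induction n)
  case 0
  show ?case by (auto intro!: derivative_eq_intros)
next
  case (Suc n)
  have "real (Suc n) * x ^ n / fact (Suc n) = x ^ n / fact n"
    by (simp del: of_nat_Suc)
  then have pow: "((\<lambda>x::real. x ^ Suc n / fact (Suc n)) has_field_derivative x ^ n / fact n) (at x)"
    using DERIV_cdivide[OF DERIV_pow[of "Suc n" x UNIV], of "fact (Suc n)"] by simp
  have exp: "((\<lambda>x::real. exp (-x)) has_field_derivative - exp (-x)) (at x)"
    by (auto intro!: derivative_eq_intros)
  have "((\<lambda>x::real. exp (-x) * x ^ Suc n / fact (Suc n)) has_field_derivative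
     exp (-x) * x ^ n / fact n - exp (-x) * x ^ Suc n / fact (Suc n)) (at x)"
    using DERIV_mult[OF exp pow] by (simp add: algebra_simps)
  from DERIV_add[OF Suc this] show ?case by (simp add: algebra_simps)
qed

lemma cell_gf_DERIV:
  assumes "1 \<le> j"
  shows "(cell_gf z j has_field_derivative cell_gf' z j x) (at x)"
proof -
  obtain n where j: "j = Suc n" using assms by (cases j) auto
  have "((\<lambda>x. 1 - z * exp (-x) - (1 - z) * (\<Sum>m<j. exp (-x) * x ^ m / fact m))
      has_field_derivative cell_gf' z j x) (at x)"
    unfolding j cell_gf'_def
    by (rule derivative_eq_intros poisson_cdf_DERIV refl | simp)+
  then show ?thesis by (simp add: cell_gf_def[abs_def])
qed

lemma cell_gf_chain_DERIV [derivative_intros]: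
  assumes "1 \<le> j" "(h has_field_derivative h') (at x within S)"
  shows "((\<lambda>x. cell_gf z j (h x)) has_field_derivative cell_gf' z j (h x) * h') (at x within S)"
  using DERIV_chain2[OF cell_gf_DERIV[OF assms(1)] assms(2)] .

lemma continuous_on_cell_gf [continuous_intros]:
  "continuous_on S h \<Longrightarrow> continuous_on S (\<lambda>x. cell_gf z j (h x))"
  "continuous_on S h \<Longrightarrow> continuous_on S (\<lambda>x. cell_gf' z j (h x))"
  unfolding cell_gf_def cell_gf'_def by (intro continuous_intros; simp)+

lemma cell_gf'_pos: "0 < z \<Longrightarrow> z < 1 \<Longrightarrow> 0 \<le> x \<Longrightarrow> 0 < cell_gf' z j x"
  unfolding cell_gf'_def by (intro add_pos_nonneg mult_nonneg_nonneg divide_nonneg_pos) auto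

lemma cell_gf_0: "1 \<le> j \<Longrightarrow> cell_gf z j 0 = 0"
  by (cases j) (simp_all add: cell_gf_def sum.lessThan_Suc_shift del: sum.lessThan_Suc)

lemma cell_gf_pos:
  assumes "0 < z" "z < 1" "1 \<le> j" "0 < x"
  shows "0 < cell_gf z j x"
proof -
  have "cell_gf z j 0 < cell_gf z j x"
  proof (rule DERIV_pos_imp_increasing_open[OF assms(4)])
    show "\<exists>y. (cell_gf z j has_real_derivative y) (at t) \<and> 0 < y" if "0 < t" for t
      using cell_gf_DERIV[OF assms(3)] cell_gf'_pos[OF assms(1,2)] that by (meson less_imp_le)
  qed (auto intro: continuous_on_cell_gf continuous_on_id)
  then show ?thesis using assms by (simp add: cell_gf_0)
qed

lemma cell_gf_nonneg:
  assumes "0 < z" "z < 1" "1 \<le> j" "0 \<le> x"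
  shows "0 \<le> cell_gf z j x"
  using cell_gf_pos[OF assms(1-3)] cell_gf_0[OF assms(3)] assms(4) by (cases "x = 0") (auto intro: less_imp_le)

lemma cell_gf_le_1:
  assumes "0 < z" "z < 1" "0 \<le> x"
  shows "cell_gf z j x \<le> 1"
proof -
  have "0 \<le> z * exp (-x)" "0 \<le> (1 - z) * (\<Sum>m<j. exp (-x) * x ^ m / fact m)"
    using assms by (auto intro!: mult_nonneg_nonneg sum_nonneg)
  then show ?thesis by (simp add: cell_gf_def)
qed

text \<open>
  The ratio of \<open>cell_gf' z j\<close> to \<open>exp (-x)\<close> is \<open>z + (1 - z) * x ^ (j - 1) / fact (j - 1)\<close>, which
  is strictly increasing. The monotonicity along the ray rests on this inequality, and the
  assumption \<open>2 \<le> j\<close> enters here: for \<open>j = 1\<close> the ratio is constant.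
\<close>
lemma cell_gf'_cross:
  assumes "z < 1" "2 \<le> j" "0 \<le> y" "y < x"
  shows "exp (-x) * cell_gf' z j y < exp (-y) * cell_gf' z j x"
proof -
  have "y ^ (j - 1) < x ^ (j - 1)"
    using assms by (intro power_strict_mono) auto
  then have "(1 - z) * exp (-x) * exp (-y) * y ^ (j - 1) < (1 - z) * exp (-x) * exp (-y) * x ^ (j - 1)"
    using assms by (intro mult_strict_left_mono) auto
  then have "(1 - z) * exp (-x) * exp (-y) * y ^ (j - 1) / fact (j - 1)
      < (1 - z) * exp (-x) * exp (-y) * x ^ (j - 1) / fact (j - 1)"
    by (intro divide_strict_right_mono) auto
  then show ?thesis by (simp add: cell_gf'_def algebra_simps)
qed

section \<open>Exponential generating functions of count weights\<close>

text \<open>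
  Exponential generating functions turn the removal of the first coupon into differentiation.
\<close>
definition egf :: "(nat \<Rightarrow> real) \<Rightarrow> real \<Rightarrow> real fps" where
  "egf w r = Abs_fps (\<lambda>c. w c * r ^ c / fact c)"

lemma egf_nth: "fps_nth (egf w r) c = w c * r ^ c / fact c"
  by (simp add: egf_def)

lemma fps_deriv_egf: "fps_deriv (egf w r) = fps_const r * egf (\<lambda>c. w (Suc c)) r"
  by (rule fps_ext) (simp add: egf_nth del: of_nat_Suc)

lemma fps_deriv_prod:
  fixes f :: "'i \<Rightarrow> 'a::comm_ring_1 fps"
  assumes "finite A"
  shows "fps_deriv (\<Prod>a\<in>A. f a) = (\<Sum>a\<in>A. fps_deriv (f a) * (\<Prod>b\<in>A - {a}. f b))"
  using assms
proof (induction A)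
  case (insert x A)
  have eq: "insert x A - {y} = insert x (A - {y})" if "y \<in> A" for y
    using insert.hyps that by auto
  show ?case
    using insert.hyps by (auto simp: insert.IH eq sum_distrib_left algebra_simps intro!: sum.cong)
qed simp

lemma fps_prod_nth_0: "fps_nth (\<Prod>a\<in>A. f a) 0 = (\<Prod>a\<in>A. fps_nth (f a :: 'a::comm_ring_1 fps) 0)"
  by (induction A rule: infinite_finite_induct) auto

lemma fps_prod_nth_nonneg:
  fixes f :: "'i \<Rightarrow> real fps"
  assumes "\<And>a n. a \<in> A \<Longrightarrow> 0 \<le> fps_nth (f a) n"
  shows "0 \<le> fps_nth (\<Prod>a\<in>A. f a) n"
  using assms
  by (induction A arbitrary: n rule: infinite_finite_induct) (auto simp: fps_mult_nth fps_one_nth intro!: sum_nonneg)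

text \<open>
  Nonnegative coefficients make every series absolutely convergent, so that Cauchy products apply.
\<close>
lemma fps_prod_sums:
  fixes f :: "'i \<Rightarrow> real fps"
  assumes "finite A" and nn: "\<And>a n. a \<in> A \<Longrightarrow> 0 \<le> fps_nth (f a) n" and x: "0 \<le> x"
    and "\<And>a. a \<in> A \<Longrightarrow> (\<lambda>n. fps_nth (f a) n * x ^ n) sums s a"
  shows "(\<lambda>n. fps_nth (\<Prod>a\<in>A. f a) n * x ^ n) sums (\<Prod>a\<in>A. s a)"
  using assms(1,2,4)
proof (induction A)
  case empty
  have "(\<lambda>n. fps_nth (1 :: real fps) n * x ^ n) = (\<lambda>n. if n = 0 then 1 else 0)"
    by (auto simp: fps_one_nth)
  then show ?case using sums_single[of 0 "\<lambda>_. 1::real"] by simp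
next
  case (insert b B)
  define G where "G = (\<Prod>a\<in>B. f a)"
  have b: "(\<lambda>n. fps_nth (f b) n * x ^ n) sums s b" and G: "(\<lambda>n. fps_nth G n * x ^ n) sums (\<Prod>a\<in>B. s a)"
    using insert by (auto simp: G_def)
  have nnG: "0 \<le> fps_nth G n" and nnb: "0 \<le> fps_nth (f b) n" for n
    using insert.prems fps_prod_nth_nonneg[of B f] by (auto simp: G_def)
  have "(\<lambda>n. \<Sum>i\<le>n. (fps_nth (f b) i * x ^ i) * (fps_nth G (n - i) * x ^ (n - i))) sums
      ((\<Sum>n. fps_nth (f b) n * x ^ n) * (\<Sum>n. fps_nth G n * x ^ n))"
    using b G nnG nnb x by (intro Cauchy_product_sums) (auto simp: sums_iff)
  also have "(\<lambda>n. \<Sum>i\<le>n. (fps_nth (f b) i * x ^ i) * (fps_nth G (n - i) * x ^ (n - i))) =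
      (\<lambda>n. fps_nth (f b * G) n * x ^ n)"
  proof
    fix n
    have "(\<Sum>i\<le>n. (fps_nth (f b) i * x ^ i) * (fps_nth G (n - i) * x ^ (n - i)))
      = (\<Sum>i\<le>n. fps_nth (f b) i * fps_nth G (n - i) * (x ^ i * x ^ (n - i)))"
      by (simp add: mult_ac)
    also have "\<dots> = (\<Sum>i\<le>n. fps_nth (f b) i * fps_nth G (n - i) * x ^ n)"
      by (intro sum.cong refl) (simp flip: power_add)
    finally show "(\<Sum>i\<le>n. (fps_nth (f b) i * x ^ i) * (fps_nth G (n - i) * x ^ (n - i))) = fps_nth (f b * G) n * x ^ n"
      by (simp add: fps_mult_nth sum_distrib_right atLeast0AtMost)
  qed
  finally show ?case
    using b G insert.hyps by (simp add: G_def[symmetric] sums_iff)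
qed

section \<open>Sequences of independent coupons\<close>

abbreviation coupon_space :: "nat pmf \<Rightarrow> (nat \<Rightarrow> nat) measure" where
  "coupon_space L \<equiv> Pi\<^sub>M UNIV (\<lambda>_::nat. measure_pmf L)"

lemma prob_space_coupon_space: "prob_space (coupon_space L)"
  by (intro prob_space_PiM prob_space_measure_pmf)

lemma measurable_coupon [measurable]: "(\<lambda>\<omega>. \<omega> k) \<in> coupon_space L \<rightarrow>\<^sub>M count_space UNIV"
  using measurable_component_singleton[of k UNIV "\<lambda>_. measure_pmf L"]
  by (simp cong: measurable_cong_sets)

text \<open>
  After the first coupon, the remaining sequence has the same law and is independent of it.
\<close>
lemma nn_integral_first_coupon:
  assumes [measurable]: "f \<in> borel_measurable (coupon_space L)" and A: "finite A" "set_pmf L \<subseteq> A"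
  shows "(\<integral>\<^sup>+\<omega>. f \<omega> \<partial>coupon_space L) = (\<Sum>s\<in>A. (\<integral>\<^sup>+\<omega>. f (case_nat s \<omega>) \<partial>coupon_space L) * pmf L s)"
proof -
  interpret P: prob_space "coupon_space L" by (rule prob_space_coupon_space)
  interpret S: sequence_space "measure_pmf L" by unfold_locales
  have m [measurable]: "(\<lambda>(s, \<omega>). case_nat s \<omega>) \<in> measure_pmf L \<Otimes>\<^sub>M coupon_space L \<rightarrow>\<^sub>M coupon_space L"
    by measurable
  have "(\<integral>\<^sup>+\<omega>. f \<omega> \<partial>coupon_space L) = (\<integral>\<^sup>+\<omega>. f \<omega> \<partial>distr (measure_pmf L \<Otimes>\<^sub>M coupon_space L) (coupon_space L) (\<lambda>(s, \<omega>). case_nat s \<omega>))"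
    by (simp only: S.PiM_iter)
  also have "\<dots> = (\<integral>\<^sup>+x. f (case x of (s, \<omega>) \<Rightarrow> case_nat s \<omega>) \<partial>(measure_pmf L \<Otimes>\<^sub>M coupon_space L))"
    by (subst nn_integral_distr) auto
  also have "\<dots> = (\<integral>\<^sup>+s. \<integral>\<^sup>+\<omega>. f (case_nat s \<omega>) \<partial>coupon_space L \<partial>measure_pmf L)"
    by (subst P.nn_integral_fst[symmetric]) auto
  also have "\<dots> = (\<Sum>s\<in>A. (\<integral>\<^sup>+\<omega>. f (case_nat s \<omega>) \<partial>coupon_space L) * pmf L s)"
    using A by (intro nn_integral_measure_pmf_support) auto
  finally show ?thesis .
qed

definition occ :: "nat \<Rightarrow> nat \<Rightarrow> (nat \<Rightarrow> nat) \<Rightarrow> nat" where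
  "occ n a \<omega> = card {k. k < n \<and> \<omega> k = a}"

lemma occ_0 [simp]: "occ 0 a \<omega> = 0" by (simp add: occ_def)

lemma occ_case_nat: "occ (Suc n) a (case_nat s \<omega>) = (if a = s then Suc (occ n a \<omega>) else occ n a \<omega>)"
proof -
  have "{k. k < Suc n \<and> case_nat s \<omega> k = a} = (if a = s then {0} else {}) \<union> Suc ` {k. k < n \<and> \<omega> k = a}"
  proof (rule set_eqI)
    fix k show "k \<in> {k. k < Suc n \<and> case_nat s \<omega> k = a} \<longleftrightarrow>
        k \<in> (if a = s then {0} else {}) \<union> Suc ` {k. k < n \<and> \<omega> k = a}"
      by (cases k) auto
  qed
  also have "card \<dots> = (if a = s then Suc (occ n a \<omega>) else occ n a \<omega>)"
    by (simp add: card_image occ_def card_insert_if)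
  finally show ?thesis by (simp add: occ_def)
qed

lemma occ_eq_0_iff: "occ n a \<omega> = 0 \<longleftrightarrow> a \<notin> \<omega> ` {..<n}"
  by (auto simp: occ_def)

lemma occ_Suc_neq: "\<omega> n \<noteq> a \<Longrightarrow> occ (Suc n) a \<omega> = occ n a \<omega>"
  by (auto simp: occ_def less_Suc_eq intro!: arg_cong[of _ _ card])

lemma occ_Suc_eq: "occ (Suc n) (\<omega> n) \<omega> = Suc (occ n (\<omega> n) \<omega>)"
proof -
  have "{k. k < Suc n \<and> \<omega> k = \<omega> n} = insert n {k. k < n \<and> \<omega> k = \<omega> n}" by auto
  then show ?thesis by (simp add: occ_def)
qed

lemma measurable_occ [measurable]: "occ n a \<in> coupon_space L \<rightarrow>\<^sub>M count_space UNIV"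
  unfolding occ_def[abs_def] by measurable

text \<open>
  The multinomial law of the counts in product form. Conditioning on the first coupon \<open>s\<close>
  shifts the weight \<open>W s\<close> by one, and this is what \<open>fps_deriv\<close> does to the generating function of
  \<open>s\<close>; so both sides obey the same recursion in \<open>n\<close>.
\<close>
lemma nn_integral_counts_then_coupon:
  assumes A: "finite A" "set_pmf L \<subseteq> A" "i \<in> A" and W: "\<And>a c. 0 \<le> W a c"
  shows "(\<integral>\<^sup>+\<omega>. ennreal (of_bool (\<omega> n = i) * (\<Prod>a\<in>A. W a (occ n a \<omega>))) \<partial>coupon_space L)
     = ennreal (pmf L i * fact n * fps_nth (\<Prod>a\<in>A. egf (W a) (pmf L a)) n)"
  using W
proof (induction n arbitrary: W)
  case 0
  interpret P: prob_space "coupon_space L" by (rule prob_space_coupon_space)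
  have "(\<integral>\<^sup>+\<omega>. ennreal (of_bool (\<omega> 0 = i) * (\<Prod>a\<in>A. W a (occ 0 a \<omega>))) \<partial>coupon_space L)
     = (\<Sum>s\<in>A. ennreal (of_bool (s = i) * (\<Prod>a\<in>A. W a 0)) * pmf L s)"
    using A by (subst nn_integral_first_coupon[of _ _ A]) (auto simp: P.emeasure_space_1)
  also have "\<dots> = (\<Sum>s\<in>{i}. ennreal (of_bool (s = i) * (\<Prod>a\<in>A. W a 0)) * pmf L s)"
    using A by (intro sum.mono_neutral_right) auto
  finally show ?case
    using 0 by (simp add: fps_prod_nth_0 egf_nth prod_nonneg mult.commute flip: ennreal_mult)
next
  case (Suc n)
  define V where "V s = W(s := (\<lambda>c. W s (Suc c)))" for s
  define E where "E s = fps_nth (\<Prod>a\<in>A. egf (V s a) (pmf L a)) n" for s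
  have V: "0 \<le> V s a c" for s a c using Suc.prems by (simp add: V_def)
  have E: "0 \<le> E s" for s
    unfolding E_def by (intro fps_prod_nth_nonneg) (simp add: egf_nth V)
  have "(\<integral>\<^sup>+\<omega>. ennreal (of_bool (\<omega> (Suc n) = i) * (\<Prod>a\<in>A. W a (occ (Suc n) a \<omega>))) \<partial>coupon_space L)
     = (\<Sum>s\<in>A. (\<integral>\<^sup>+\<omega>. ennreal (of_bool (\<omega> n = i) * (\<Prod>a\<in>A. V s a (occ n a \<omega>))) \<partial>coupon_space L) * pmf L s)"
    using A by (subst nn_integral_first_coupon[of _ _ A])
      (auto intro!: sum.cong nn_integral_cong prod.cong arg_cong2[of _ _ _ _ "(*)"] arg_cong[of _ _ ennreal]
        simp: occ_case_nat V_def)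
  also have "\<dots> = (\<Sum>s\<in>A. ennreal (pmf L i * fact n * E s * pmf L s))"
    using E by (intro sum.cong refl) (subst Suc.IH[of "V s" for s, OF V], simp add: E_def[symmetric] ennreal_mult)
  also have "\<dots> = ennreal (\<Sum>s\<in>A. pmf L i * fact n * E s * pmf L s)"
    using E by (intro sum_ennreal) auto
  also have "(\<Sum>s\<in>A. pmf L i * fact n * E s * pmf L s) = pmf L i * fact n * (\<Sum>s\<in>A. pmf L s * E s)"
    by (simp add: sum_distrib_left mult_ac)
  also have "(\<Sum>s\<in>A. pmf L s * E s) = fps_nth (fps_deriv (\<Prod>a\<in>A. egf (W a) (pmf L a))) n"
  proof -
    have "fps_deriv (\<Prod>a\<in>A. egf (W a) (pmf L a)) = (\<Sum>s\<in>A. fps_const (pmf L s) * (\<Prod>a\<in>A. egf (V s a) (pmf L a)))"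
      unfolding fps_deriv_prod[OF A(1)]
      by (intro sum.cong refl) (simp add: fps_deriv_egf V_def prod.remove[OF A(1)] mult.assoc)
    then show ?thesis by (simp add: fps_sum_nth E_def)
  qed
  also have "pmf L i * fact n * \<dots> = pmf L i * fact (Suc n) * fps_nth (\<Prod>a\<in>A. egf (W a) (pmf L a)) (Suc n)"
    by simp
  finally show ?case .
qed

text \<open>
  The probability \<open>Q\<close> that \<open>i\<close> never appears satisfies \<open>Q = Q * (1 - pmf L i)\<close>, by
  conditioning on the first coupon.
\<close>
lemma AE_coupon_appears:
  assumes A: "finite (set_pmf L)" and i: "0 < pmf L i"
  shows "AE \<omega> in coupon_space L. \<exists>k. \<omega> k = i"
proof -
  interpret P: prob_space "coupon_space L" by (rule prob_space_coupon_space)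
  define Q where "Q = (\<integral>\<^sup>+\<omega>. of_bool (\<forall>k. \<omega> k \<noteq> i) \<partial>coupon_space L)"
  have "Q \<le> (\<integral>\<^sup>+\<omega>. 1 \<partial>coupon_space L)" unfolding Q_def by (intro nn_integral_mono) auto
  then have fin: "Q < top" by (simp add: P.emeasure_space_1 order_le_less_trans)
  have nn: "(\<integral>\<^sup>+\<omega>. of_bool (\<forall>k. case_nat s \<omega> k \<noteq> i) \<partial>coupon_space L) = of_bool (s \<noteq> i) * Q" for s
  proof -
    have eq: "(\<forall>k. case_nat s \<omega> k \<noteq> i) \<longleftrightarrow> s \<noteq> i \<and> (\<forall>k. \<omega> k \<noteq> i)" for \<omega> :: "nat \<Rightarrow> nat"
      by (metis nat.case nat.exhaust)
    show ?thesis unfolding eq Q_def by (cases "s = i") simp_all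
  qed
  have "Q = (\<Sum>s\<in>set_pmf L. of_bool (s \<noteq> i) * Q * pmf L s)"
    unfolding Q_def by (subst nn_integral_first_coupon[OF _ A order_refl]) (simp_all add: nn Q_def[symmetric])
  also have "\<dots> = (\<Sum>s\<in>set_pmf L - {i}. Q * pmf L s)"
    using A by (intro sum.mono_neutral_cong_right) auto
  also have "\<dots> = Q * ennreal (\<Sum>s\<in>set_pmf L - {i}. pmf L s)"
    by (simp add: sum_distrib_left[symmetric] sum_ennreal)
  also have "(\<Sum>s\<in>set_pmf L - {i}. pmf L s) = 1 - pmf L i"
    using A i by (simp add: sum_diff1 sum_pmf_eq_1 set_pmf_iff)
  finally have eq: "Q = Q * ennreal (1 - pmf L i)" .
  have "Q = 0"
  proof -
    from fin obtain r where r: "Q = ennreal r" "0 \<le> r" by (cases Q) auto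
    from eq r have "ennreal r = ennreal (r * (1 - pmf L i))"
      by (simp add: ennreal_mult pmf_le_1)
    then have "r = r * (1 - pmf L i)"
      using r by (subst (asm) ennreal_inj) (simp_all add: pmf_le_1)
    with i show ?thesis by (simp add: r algebra_simps)
  qed
  then have "AE \<omega> in coupon_space L. of_bool (\<forall>k. \<omega> k \<noteq> i) = (0::ennreal)"
    unfolding Q_def by (subst (asm) nn_integral_0_iff_AE) auto
  then show ?thesis by eventually_elim auto
qed

lemma pmf_coupon_law:
  assumes "\<And>i. i \<in> {1..N} \<Longrightarrow> 0 < q i" "(\<Sum>i=1..N. q i) = 1"
  shows "pmf (coupon_law N q) i = (if i \<in> {1..N} then q i else 0)"
  unfolding coupon_law_def
proof (rule pmf_embed_pmf)
  show "0 \<le> (if i \<in> {1..N} then q i else 0)" for i using assms(1)[of i] by auto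
  have "(\<integral>\<^sup>+ x. ennreal (if x \<in> {1..N} then q x else 0) \<partial>count_space UNIV)
     = (\<Sum>x\<in>{1..N}. ennreal (if x \<in> {1..N} then q x else 0))"
    by (rule nn_integral_count_space') auto
  also have "\<dots> = ennreal (\<Sum>x\<in>{1..N}. q x)"
    using assms(1) by (subst sum_ennreal[symmetric]) (auto intro: less_imp_le)
  finally show "(\<integral>\<^sup>+ x. ennreal (if x \<in> {1..N} then q x else 0) \<partial>count_space UNIV) = 1"
    using assms(2) by simp
qed

lemma set_coupon_law:
  assumes "\<And>i. i \<in> {1..N} \<Longrightarrow> 0 < q i" "(\<Sum>i=1..N. q i) = 1"
  shows "set_pmf (coupon_law N q) = {1..N}"
proof (rule set_eqI)
  fix i
  have "pmf (coupon_law N q) i = (if i \<in> {1..N} then q i else 0)"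
    using assms by (intro pmf_coupon_law) auto
  then show "i \<in> set_pmf (coupon_law N q) \<longleftrightarrow> i \<in> {1..N}"
    using assms(1)[of i] by (auto simp: set_pmf_eq)
qed

section \<open>The expansion over the last coupon\<close>

text \<open>
  The contribution of type \<open>a\<close>, drawn \<open>c\<close> times before the last coupon, to the event that this
  last coupon has type \<open>i\<close> and completes the first album, times its contribution to
  \<open>z ^ U\<close>. Type \<open>i\<close> itself must not have been drawn; its factor \<open>z\<close> is kept apart, so that its
  generating function is \<open>1\<close>.
\<close>
definition final_weight :: "real \<Rightarrow> nat \<Rightarrow> nat \<Rightarrow> nat \<Rightarrow> nat \<Rightarrow> real" where
  "final_weight z j i a c =
     (if a = i then of_bool (c = 0) else if c = 0 then 0 else if c < j then z else 1)"

lemma final_weight_nonneg: "0 < z \<Longrightarrow> 0 \<le> final_weight z j i a c"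
  by (simp add: final_weight_def)

lemma finite_prefix_covers:
  assumes "finite A" "A \<subseteq> range \<omega>"
  obtains t :: nat where "A \<subseteq> \<omega> ` {..<t}"
proof -
  obtain C where C: "finite C" "A = \<omega> ` C"
    using finite_subset_image[OF assms] by blast
  then obtain t where "C \<subseteq> {..<t}" by (auto simp: finite_nat_iff_bounded)
  with C show thesis by (intro that[of t]) auto
qed

text \<open>
  This lemma and the next one express completion of the first album by the counts before the last
  coupon: the last coupon is new, and every other type has been drawn.
\<close>
lemma counts_before_stop:
  assumes "\<tau> N \<omega> = Suc n" "{1..N} \<subseteq> range \<omega>"
  shows "\<omega> n \<in> {1..N}" "occ n (\<omega> n) \<omega> = 0" "\<And>a. a \<in> {1..N} \<Longrightarrow> a \<noteq> \<omega> n \<Longrightarrow> occ n a \<omega> \<noteq> 0"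
proof -
  obtain t where t: "{1..N} \<subseteq> \<omega> ` {..<t}"
    using finite_prefix_covers[OF _ assms(2)] by auto
  have sub: "{1..N} \<subseteq> \<omega> ` {..<Suc n}"
    unfolding assms(1)[symmetric] \<tau>_def using t by (rule LeastI)
  have "\<not> {1..N} \<subseteq> \<omega> ` {..<n}"
    using not_less_Least[of n "\<lambda>t. {1..N} \<subseteq> \<omega> ` {..<t}"] assms(1) by (simp add: \<tau>_def)
  then obtain a where a: "a \<in> {1..N}" "a \<notin> \<omega> ` {..<n}" by blast
  with sub have "a = \<omega> n" by (auto simp: lessThan_Suc)
  with a show "\<omega> n \<in> {1..N}" "occ n (\<omega> n) \<omega> = 0" by (auto simp: occ_eq_0_iff)
  show "occ n a \<omega> \<noteq> 0" if "a \<in> {1..N}" "a \<noteq> \<omega> n" for a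
    using sub that by (auto simp: occ_eq_0_iff lessThan_Suc)
qed

lemma stop_from_counts:
  assumes "\<omega> n \<in> {1..N}" "occ n (\<omega> n) \<omega> = 0" "\<And>a. a \<in> {1..N} \<Longrightarrow> a \<noteq> \<omega> n \<Longrightarrow> occ n a \<omega> \<noteq> 0"
  shows "\<tau> N \<omega> = Suc n"
  unfolding \<tau>_def
proof (rule Least_equality)
  show "{1..N} \<subseteq> \<omega> ` {..<Suc n}"
  proof
    fix a assume "a \<in> {1..N}"
    then show "a \<in> \<omega> ` {..<Suc n}"
      using assms(3)[of a] by (cases "a = \<omega> n") (auto simp: occ_eq_0_iff lessThan_Suc)
  qed
  show "Suc n \<le> t" if "{1..N} \<subseteq> \<omega> ` {..<t}" for t
  proof (rule ccontr)
    assume "\<not> Suc n \<le> t"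
    then have "\<omega> ` {..<t} \<subseteq> \<omega> ` {..<n}" by auto
    with that assms(1) have "\<omega> n \<in> \<omega> ` {..<n}" by blast
    with assms(2) show False by (simp add: occ_eq_0_iff)
  qed
qed

text \<open>
  Exactly one term of the double series is nonzero, namely the one for \<open>n = \<tau> N \<omega> - 1\<close> and
  \<open>i = \<omega> n\<close>.
\<close>
lemma power_U_expansion:
  assumes "1 \<le> N" "2 \<le> j" "0 < z" and all: "{1..N} \<subseteq> range \<omega>"
  shows "(\<Sum>n. \<Sum>i\<in>{1..N}. ennreal (z * (of_bool (\<omega> n = i) * (\<Prod>a\<in>{1..N}. final_weight z j i a (occ n a \<omega>)))))
     = ennreal (z ^ U N j \<omega>)"
proof -
  define g where "g n i = z * (of_bool (\<omega> n = i) * (\<Prod>a\<in>{1..N}. final_weight z j i a (occ n a \<omega>)))" for n i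
  obtain t where t: "{1..N} \<subseteq> \<omega> ` {..<t}"
    using finite_prefix_covers[OF _ all] by auto
  have "{1..N} \<subseteq> \<omega> ` {..<\<tau> N \<omega>}" unfolding \<tau>_def using t by (rule LeastI)
  with assms(1) have "\<tau> N \<omega> \<noteq> 0" by auto
  then obtain m where m: "\<tau> N \<omega> = Suc m" by (cases "\<tau> N \<omega>") auto
  note stop = counts_before_stop[OF m all]
  have zero: "g n i = 0" if "i \<in> {1..N}" "\<not> (n = m \<and> i = \<omega> m)" for n i
  proof (rule ccontr)
    assume "g n i \<noteq> 0"
    then have i: "\<omega> n = i" and nz: "\<And>a. a \<in> {1..N} \<Longrightarrow> final_weight z j i a (occ n a \<omega>) \<noteq> 0"
      by (auto simp: g_def)
    have "\<tau> N \<omega> = Suc n"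
    proof (rule stop_from_counts)
      show "\<omega> n \<in> {1..N}" using that(1) i by simp
      show "occ n (\<omega> n) \<omega> = 0" using nz[of i] that(1) i by (auto simp: final_weight_def)
      show "occ n a \<omega> \<noteq> 0" if "a \<in> {1..N}" "a \<noteq> \<omega> n" for a
      proof
        assume "occ n a \<omega> = 0"
        with that i have "final_weight z j i a (occ n a \<omega>) = 0" by (simp add: final_weight_def)
        with nz[OF that(1)] show False by simp
      qed
    qed
    with m i that(2) show False by simp
  qed
  have "(\<Sum>n. \<Sum>i\<in>{1..N}. ennreal (g n i)) = (\<Sum>n\<in>{m}. \<Sum>i\<in>{1..N}. ennreal (g n i))"
    using zero by (intro suminf_finite) auto
  also have "\<dots> = (\<Sum>i\<in>{1..N}. ennreal (g m i))"
    by simp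
  also have "\<dots> = (\<Sum>i\<in>{\<omega> m}. ennreal (g m i))"
    using zero stop(1) by (intro sum.mono_neutral_right) auto
  also have "\<dots> = ennreal (z ^ U N j \<omega>)"
  proof -
    have "z ^ U N j \<omega> = (\<Prod>a\<in>{a\<in>{1..N}. occ (Suc m) a \<omega> < j}. z)"
      using assms(2) U_eq[of j N \<omega>] by (simp add: m occ_def)
    also have "\<dots> = (\<Prod>a\<in>{1..N}. if occ (Suc m) a \<omega> < j then z else 1)"
      by (rule prod.inter_filter) simp
    also have "\<dots> = z * (\<Prod>a\<in>{1..N} - {\<omega> m}. if occ (Suc m) a \<omega> < j then z else 1)"
      using stop assms(2) by (subst prod.remove[of _ "\<omega> m"]) (auto simp: occ_Suc_eq)
    also have "(\<Prod>a\<in>{1..N} - {\<omega> m}. if occ (Suc m) a \<omega> < j then z else 1)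
       = (\<Prod>a\<in>{1..N} - {\<omega> m}. final_weight z j (\<omega> m) a (occ m a \<omega>))"
    proof (intro prod.cong refl)
      fix a assume "a \<in> {1..N} - {\<omega> m}"
      with stop(3)[of a] show "(if occ (Suc m) a \<omega> < j then z else 1) = final_weight z j (\<omega> m) a (occ m a \<omega>)"
        by (simp add: final_weight_def occ_Suc_neq)
    qed
    also have "\<dots> = (\<Prod>a\<in>{1..N}. final_weight z j (\<omega> m) a (occ m a \<omega>))"
      using prod.remove[of "{1..N}" "\<omega> m" "\<lambda>a. final_weight z j (\<omega> m) a (occ m a \<omega>)"] stop(1,2)
      by (simp add: final_weight_def)
    finally show ?thesis by (simp add: g_def)
  qed
  finally show ?thesis by (simp add: g_def)
qed

section \<open>The integral representation\<close>

text \<open>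
  With Poisson arrivals of rate \<open>q i\<close> for each type, this is the density in \<open>t\<close> of the completion
  time of the first album, weighted by \<open>z\<close> for every type other than the last one whose count is
  below \<open>j\<close>.
\<close>
definition finish_rate :: "real \<Rightarrow> nat \<Rightarrow> 'a set \<Rightarrow> ('a \<Rightarrow> real) \<Rightarrow> real \<Rightarrow> real" where
  "finish_rate z j A q t =
     (\<Sum>i\<in>A. q i * exp (- (q i * t)) * (\<Prod>k\<in>A - {i}. cell_gf z j (q k * t)))"

lemma final_weight_other_sums:
  assumes "1 \<le> j" "a \<noteq> i"
  shows "(\<lambda>c. fps_nth (egf (final_weight z j i a) r) c * x ^ c) sums (exp (r * x) * cell_gf z j (r * x))"
proof -
  define y where "y = r * x"
  have e: "(\<lambda>c. y ^ c / fact c) sums exp y"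
    using exp_converges[of y] by (simp add: divide_inverse mult.commute)
  have p: "(\<lambda>c. if c \<in> {..<j} then y ^ c / fact c else 0) sums (\<Sum>c<j. y ^ c / fact c)"
    by (rule sums_If_finite_set) simp
  have o: "(\<lambda>c. if c = 0 then 1 else 0) sums (1::real)" by (rule sums_single)
  have "(\<lambda>c. y ^ c / fact c - z * (if c = 0 then 1 else 0) - (1 - z) * (if c \<in> {..<j} then y ^ c / fact c else 0))
     sums (exp y - z * 1 - (1 - z) * (\<Sum>c<j. y ^ c / fact c))"
    by (intro sums_diff sums_mult e p o)
  also have "(\<lambda>c. y ^ c / fact c - z * (if c = 0 then 1 else 0) - (1 - z) * (if c \<in> {..<j} then y ^ c / fact c else 0))
     = (\<lambda>c. fps_nth (egf (final_weight z j i a) r) c * x ^ c)"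
    using assms by (auto simp: fun_eq_iff egf_nth final_weight_def y_def power_mult_distrib algebra_simps)
  also have "exp y - z * 1 - (1 - z) * (\<Sum>c<j. y ^ c / fact c) = exp y * cell_gf z j y"
  proof -
    define S where "S = (\<Sum>c<j. y ^ c / fact c)"
    have "exp y * cell_gf z j y = exp y - z * (exp y * exp (-y)) - (1 - z) * (exp y * exp (-y) * S)"
      by (simp add: cell_gf_def S_def sum_distrib_left algebra_simps)
    then show ?thesis by (simp add: exp_minus S_def)
  qed
  finally show ?thesis by (simp add: y_def)
qed

lemma final_weight_last_sums: "(\<lambda>c. fps_nth (egf (final_weight z j i i) r) c * x ^ c) sums 1"
proof -
  have "(\<lambda>c. fps_nth (egf (final_weight z j i i) r) c * x ^ c) = (\<lambda>c. if c = 0 then 1 else 0)"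
    by (auto simp: egf_nth final_weight_def)
  then show ?thesis using sums_single[of 0 "\<lambda>_. 1::real"] by simp
qed

text \<open>
  The factor \<open>exp (-x)\<close> splits over the types because the \<open>r a\<close> sum to \<open>1\<close>; each share turns the
  exponential generating function of its type into a Poisson expectation.
\<close>
lemma final_weight_prod_sums:
  assumes A: "finite A" "i \<in> A" and r: "\<And>a. a \<in> A \<Longrightarrow> 0 \<le> r a" "(\<Sum>a\<in>A. r a) = 1"
    and z: "0 < z" "1 \<le> j" and x: "0 \<le> x"
  shows "(\<lambda>n. fps_nth (\<Prod>a\<in>A. egf (final_weight z j i a) (r a)) n * (x ^ n * exp (-x)))
     sums (exp (- (r i * x)) * (\<Prod>a\<in>A - {i}. cell_gf z j (r a * x)))"
proof -
  define s where "s a = (if a = i then 1 else exp (r a * x) * cell_gf z j (r a * x))" for a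
  have "(\<lambda>n. fps_nth (\<Prod>a\<in>A. egf (final_weight z j i a) (r a)) n * x ^ n) sums (\<Prod>a\<in>A. s a)"
    using A r z x final_weight_other_sums final_weight_last_sums final_weight_nonneg
    by (intro fps_prod_sums) (auto simp: s_def egf_nth)
  then have "(\<lambda>n. exp (-x) * (fps_nth (\<Prod>a\<in>A. egf (final_weight z j i a) (r a)) n * x ^ n))
      sums (exp (-x) * (\<Prod>a\<in>A. s a))"
    by (rule sums_mult)
  also have "exp (-x) * (\<Prod>a\<in>A. s a) = exp (- (r i * x)) * (\<Prod>a\<in>A - {i}. cell_gf z j (r a * x))"
  proof -
    have "(\<Prod>a\<in>A. s a) = (\<Prod>a\<in>A - {i}. exp (r a * x)) * (\<Prod>a\<in>A - {i}. cell_gf z j (r a * x))"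
      using A by (subst prod.remove[of _ i]) (auto simp: s_def prod.distrib[symmetric] intro!: prod.cong)
    also have "(\<Prod>a\<in>A - {i}. exp (r a * x)) = exp ((1 - r i) * x)"
      using A r by (simp add: exp_sum[symmetric] sum_distrib_right[symmetric] sum_diff1)
    finally have "exp (-x) * (\<Prod>a\<in>A. s a) = exp (-x) * exp ((1 - r i) * x) * (\<Prod>a\<in>A - {i}. cell_gf z j (r a * x))"
      by (simp add: mult.assoc)
    also have "exp (-x) * exp ((1 - r i) * x) = exp (- (r i * x))"
      by (simp add: exp_add[symmetric] algebra_simps)
    finally show ?thesis .
  qed
  finally show ?thesis by (simp add: mult_ac)
qed

lemma finish_rate_borel [measurable]: "finish_rate z j A q \<in> borel_measurable borel"
  unfolding finish_rate_def[abs_def] cell_gf_def by measurable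

lemma finish_rate_nonneg:
  assumes "0 < z" "z < 1" "1 \<le> j" "\<And>i. i \<in> A \<Longrightarrow> 0 \<le> q i" "0 \<le> t"
  shows "0 \<le> finish_rate z j A q t"
  using assms unfolding finish_rate_def
  by (intro sum_nonneg mult_nonneg_nonneg prod_nonneg cell_gf_nonneg) auto

text \<open>
  The integral representation: sum the expansion of \<open>z ^ U\<close> term by term and replace each \<open>n!\<close> by
  an integral. All terms are nonnegative, so that sums and integrals may be exchanged.
\<close>
lemma nn_integral_power_U:
  assumes N: "1 \<le> N" and j: "2 \<le> j" and z: "0 < z" "z < 1"
    and q: "\<And>i. i \<in> {1..N} \<Longrightarrow> 0 < q i" "(\<Sum>i=1..N. q i) = 1"
  shows "(\<integral>\<^sup>+\<omega>. ennreal (z ^ U N j \<omega>) \<partial>draws N q)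
     = (\<integral>\<^sup>+t. ennreal (z * finish_rate z j {1..N} q t) * indicator {0..} t \<partial>lborel)"
proof -
  define L where "L = coupon_law N q"
  define A where "A = {1..N}"
  define c where "c i n = fps_nth (\<Prod>a\<in>A. egf (final_weight z j i a) (q a)) n" for i n
  have draws: "draws N q = coupon_space L" by (simp add: draws_def L_def)
  have A: "finite A" "set_pmf L \<subseteq> A" "set_pmf L = A"
    using set_coupon_law[of N q] q by (auto simp: A_def L_def)
  have pmf: "pmf L i = q i" if "i \<in> A" for i
    using that pmf_coupon_law[of N q i] q by (simp add: L_def A_def)
  have q0: "0 < q i" if "i \<in> A" for i using q that by (simp add: A_def)
  have c0: "0 \<le> c i n" for i n
    unfolding c_def using q0 z by (intro fps_prod_nth_nonneg) (auto simp: egf_nth final_weight_nonneg less_imp_le)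
  have "AE \<omega> in coupon_space L. \<forall>i\<in>A. \<exists>k. \<omega> k = i"
    using A q0 by (intro AE_finite_allI AE_coupon_appears) (auto simp: pmf)
  then have "AE \<omega> in coupon_space L. ennreal (z ^ U N j \<omega>) =
     (\<Sum>n. \<Sum>i\<in>A. ennreal (z * (of_bool (\<omega> n = i) * (\<Prod>a\<in>A. final_weight z j i a (occ n a \<omega>)))))"
  proof eventually_elim
    case (elim \<omega>)
    then have "{1..N} \<subseteq> range \<omega>" by (force simp: A_def)
    from power_U_expansion[OF N j z(1) this] show ?case by (simp add: A_def)
  qed
  then have "(\<integral>\<^sup>+\<omega>. ennreal (z ^ U N j \<omega>) \<partial>draws N q) =
     (\<integral>\<^sup>+\<omega>. (\<Sum>n. \<Sum>i\<in>A. ennreal (z * (of_bool (\<omega> n = i) * (\<Prod>a\<in>A. final_weight z j i a (occ n a \<omega>))))) \<partial>coupon_space L)"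
    unfolding draws by (rule nn_integral_cong_AE)
  also have "\<dots> = (\<Sum>n. \<Sum>i\<in>A. \<integral>\<^sup>+\<omega>. ennreal (z * (of_bool (\<omega> n = i) * (\<Prod>a\<in>A. final_weight z j i a (occ n a \<omega>)))) \<partial>coupon_space L)"
    by (simp add: nn_integral_suminf nn_integral_sum)
  also have "\<dots> = (\<Sum>n. \<Sum>i\<in>A. ennreal (z * q i * c i n) * ennreal (fact n))"
  proof (intro suminf_cong sum.cong refl)
    fix n i assume i: "i \<in> A"
    have "(\<integral>\<^sup>+\<omega>. ennreal (z * (of_bool (\<omega> n = i) * (\<Prod>a\<in>A. final_weight z j i a (occ n a \<omega>)))) \<partial>coupon_space L)
      = ennreal z * (\<integral>\<^sup>+\<omega>. ennreal (of_bool (\<omega> n = i) * (\<Prod>a\<in>A. final_weight z j i a (occ n a \<omega>))) \<partial>coupon_space L)"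
      using z by (simp add: ennreal_mult' nn_integral_cmult)
    also have "\<dots> = ennreal z * ennreal (q i * fact n * c i n)"
      using nn_integral_counts_then_coupon[OF A(1,2) i, of "final_weight z j i" n] z i
      by (simp add: final_weight_nonneg pmf c_def)
    also have "\<dots> = ennreal (z * q i * c i n) * ennreal (fact n)"
      using z q0[OF i] c0[of i n] by (simp add: ennreal_mult[symmetric] mult_ac)
    finally show "(\<integral>\<^sup>+\<omega>. ennreal (z * (of_bool (\<omega> n = i) * (\<Prod>a\<in>A. final_weight z j i a (occ n a \<omega>)))) \<partial>coupon_space L)
      = ennreal (z * q i * c i n) * ennreal (fact n)" .
  qed
  also have "\<dots> = (\<Sum>n. \<Sum>i\<in>A. \<integral>\<^sup>+x. ennreal (z * q i * c i n) * (ennreal (x ^ n * exp (-x)) * indicator {0..} x) \<partial>lborel)"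
    by (subst nn_integral_cmult) (simp_all add: nn_intergal_power_times_exp_Ici)
  also have "\<dots> = (\<integral>\<^sup>+x. (\<Sum>n. \<Sum>i\<in>A. ennreal (z * q i * c i n) * (ennreal (x ^ n * exp (-x)) * indicator {0..} x)) \<partial>lborel)"
    by (simp add: nn_integral_suminf nn_integral_sum)
  also have "\<dots> = (\<integral>\<^sup>+t. ennreal (z * finish_rate z j {1..N} q t) * indicator {0..} t \<partial>lborel)"
  proof (intro nn_integral_cong)
    fix x :: real
    show "(\<Sum>n. \<Sum>i\<in>A. ennreal (z * q i * c i n) * (ennreal (x ^ n * exp (-x)) * indicator {0..} x))
      = ennreal (z * finish_rate z j {1..N} q x) * indicator {0..} x"
    proof (cases "0 \<le> x")
      case True
      have "(\<lambda>n. \<Sum>i\<in>A. z * q i * (c i n * (x ^ n * exp (-x)))) sums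
         (\<Sum>i\<in>A. z * q i * (exp (- (q i * x)) * (\<Prod>a\<in>A - {i}. cell_gf z j (q a * x))))"
        unfolding c_def using A q0 q z j True
        by (intro sums_sum sums_mult final_weight_prod_sums) (auto intro: less_imp_le simp: A_def)
      also have "(\<Sum>i\<in>A. z * q i * (exp (- (q i * x)) * (\<Prod>a\<in>A - {i}. cell_gf z j (q a * x)))) = z * finish_rate z j {1..N} q x"
        by (simp add: finish_rate_def A_def sum_distrib_left mult_ac)
      finally have s: "(\<lambda>n. \<Sum>i\<in>A. z * q i * (c i n * (x ^ n * exp (-x)))) sums (z * finish_rate z j {1..N} q x)" .
      have "(\<Sum>n. \<Sum>i\<in>A. ennreal (z * q i * c i n) * (ennreal (x ^ n * exp (-x)) * indicator {0..} x))
         = (\<Sum>n. ennreal (\<Sum>i\<in>A. z * q i * (c i n * (x ^ n * exp (-x)))))"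
        using True z q0 c0
        by (intro suminf_cong, subst sum_ennreal[symmetric])
          (auto intro!: sum.cong mult_nonneg_nonneg simp: ennreal_mult[symmetric] less_imp_le mult_ac)
      also have "\<dots> = ennreal (z * finish_rate z j {1..N} q x)"
        using s True z q0 c0
        by (subst suminf_ennreal2) (auto intro!: sum_nonneg mult_nonneg_nonneg simp: sums_iff less_imp_le)
      finally show ?thesis using True by simp
    qed simp
  qed
  finally show ?thesis .
qed

text \<open>
  The Bochner integral of a function that is not measurable is \<open>0\<close>, so measurability is needed to
  pass from the nonnegative integral to the expectation.
\<close>
lemma measurable_U:
  assumes "1 \<le> j"
  shows "U N j \<in> coupon_space L \<rightarrow>\<^sub>M count_space UNIV"
proof -
  have [measurable]: "\<tau> N \<in> coupon_space L \<rightarrow>\<^sub>M count_space UNIV"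
    unfolding \<tau>_def[abs_def] image_def subset_eq by measurable
  have "(\<lambda>\<omega>. card {i\<in>{1..N}. occ (\<tau> N \<omega>) i \<omega> < j}) \<in> coupon_space L \<rightarrow>\<^sub>M count_space UNIV"
  proof (rule measurable_compose_countable[where f = "\<lambda>t \<omega>. card {i\<in>{1..N}. occ t i \<omega> < j}" and g = "\<tau> N"])
    show "(\<lambda>\<omega>. card {i\<in>{1..N}. occ t i \<omega> < j}) \<in> coupon_space L \<rightarrow>\<^sub>M count_space UNIV" for t
      by measurable
  qed measurable
  moreover have "U N j = (\<lambda>\<omega>. card {i\<in>{1..N}. occ (\<tau> N \<omega>) i \<omega> < j})"
    using assms by (auto simp: U_eq occ_def)
  ultimately show ?thesis by (simp only:)
qed

lemma truncated_finish_rate_LIMSEQ: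
  assumes N: "1 \<le> N" and j: "2 \<le> j" and z: "0 < z" "z < 1"
    and q: "\<And>i. i \<in> {1..N} \<Longrightarrow> 0 < q i" "(\<Sum>i=1..N. q i) = 1"
  shows "(\<lambda>n. integral {0..real n} (finish_rate z j {1..N} q)) \<longlonglongrightarrow> (LINT \<omega>|draws N q. z ^ U N j \<omega>) / z"
proof -
  define L where "L = coupon_law N q"
  have draws: "draws N q = coupon_space L" by (simp add: draws_def L_def)
  interpret P: prob_space "coupon_space L" by (rule prob_space_coupon_space)
  note [measurable] = measurable_U[of j N L]
  define f where "f = finish_rate z j {1..N} q"
  have f0: "0 \<le> f t" if "0 \<le> t" for t
    unfolding f_def using that z j q by (intro finish_rate_nonneg) (auto intro: less_imp_le)
  have [measurable]: "f \<in> borel_measurable borel" unfolding f_def by measurable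
  define g where "g t = z * f t * indicator {0..} t" for t
  have g0: "0 \<le> g t" for t using f0[of t] z by (auto simp: g_def split: split_indicator)
  have int: "integrable (coupon_space L) (\<lambda>\<omega>. z ^ U N j \<omega>)"
    using z j by (intro P.integrable_const_bound[of _ 1]) (auto simp: power_le_one)
  have "ennreal (LINT \<omega>|coupon_space L. z ^ U N j \<omega>) = (\<integral>\<^sup>+\<omega>. ennreal (z ^ U N j \<omega>) \<partial>coupon_space L)"
    using z by (intro nn_integral_eq_integral[symmetric] int) auto
  also have "\<dots> = (\<integral>\<^sup>+t. ennreal (g t) \<partial>lborel)"
    unfolding draws[symmetric] using N j z q
    by (subst nn_integral_power_U) (auto intro!: nn_integral_cong simp: g_def f_def split: split_indicator)
  finally have nn: "(\<integral>\<^sup>+t. ennreal (g t) \<partial>lborel) = ennreal (LINT \<omega>|coupon_space L. z ^ U N j \<omega>)" ..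
  have g: "has_bochner_integral lborel g (LINT \<omega>|coupon_space L. z ^ U N j \<omega>)"
  proof (rule has_bochner_integral_nn_integral[OF _ _ _ nn])
    show "g \<in> borel_measurable lborel" unfolding g_def[abs_def] by measurable
    show "AE t in lborel. 0 \<le> g t" using g0 by simp
    show "0 \<le> (LINT \<omega>|coupon_space L. z ^ U N j \<omega>)" using z by (intro integral_nonneg_AE) simp
  qed
  have "((\<lambda>y. LINT t|lborel. indicator {..y} t *\<^sub>R g t) \<longlongrightarrow> (LINT t|lborel. g t)) at_top"
    using g by (intro tendsto_integral_at_top) (auto simp: has_bochner_integral_iff)
  then have "(\<lambda>n. LINT t|lborel. indicator {..real n} t *\<^sub>R g t) \<longlonglongrightarrow> (LINT t|lborel. g t)"
    by (rule filterlim_compose) (rule filterlim_real_sequentially)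
  moreover have "(LINT t|lborel. indicator {..real n} t *\<^sub>R g t) = z * integral {0..real n} f" for n
  proof -
    have "continuous_on {0..real n} f"
      unfolding f_def finish_rate_def by (intro continuous_intros)
    then have "set_integrable lborel {0..real n} f"
      unfolding set_integrable_def by (intro borel_integrable_compact) auto
    from set_borel_integral_eq_integral(2)[OF this]
    have "integral {0..real n} f = (LINT t|lborel. indicator {0..real n} t *\<^sub>R f t)"
      by (simp add: set_lebesgue_integral_def)
    moreover have "(LINT t|lborel. indicator {..real n} t *\<^sub>R g t) = (LINT t|lborel. z * (indicator {0..real n} t *\<^sub>R f t))"
      by (intro Bochner_Integration.integral_cong) (auto simp: g_def split: split_indicator)
    ultimately show ?thesis by simp
  qed
  ultimately have "(\<lambda>n. z * integral {0..real n} f) \<longlonglongrightarrow> (LINT \<omega>|coupon_space L. z ^ U N j \<omega>)"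
    using has_bochner_integral_integral_eq[OF g] by simp
  then have "(\<lambda>n. (z * integral {0..real n} f) / z) \<longlonglongrightarrow> (LINT \<omega>|coupon_space L. z ^ U N j \<omega>) / z"
    using z by (intro tendsto_divide tendsto_const) auto
  then show ?thesis using z by (simp add: f_def draws)
qed

section \<open>Monotonicity along a ray from the uniform law\<close>

text \<open>
  The rates at parameter \<open>\<theta>\<close> are \<open>u + \<theta> * d i\<close>, where \<open>d\<close> stands for the difference of the given law
  and the uniform one. Two types with different speeds \<open>d i\<close> keep the source from vanishing.
\<close>
locale ray_flow =
  fixes z :: real and j :: nat and A :: "'a set" and u :: real and d :: "'a \<Rightarrow> real"
  assumes z: "0 < z" "z < 1" and j: "2 \<le> j" and A: "finite A" and u: "0 < u"
    and ray_pos: "\<And>\<theta> i. 0 \<le> \<theta> \<Longrightarrow> \<theta> \<le> 1 \<Longrightarrow> i \<in> A \<Longrightarrow> 0 < u + \<theta> * d i"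
    and d_neq: "\<exists>i\<in>A. \<exists>l\<in>A. d i \<noteq> d l"
begin

definition q :: "real \<Rightarrow> 'a \<Rightarrow> real" where "q \<theta> i = u + \<theta> * d i"

definition other_cells :: "real \<Rightarrow> real \<Rightarrow> 'a \<Rightarrow> 'a \<Rightarrow> real" where
  "other_cells \<theta> t l m = (\<Prod>k\<in>A - {l} - {m}. cell_gf z j (q \<theta> k * t))"

text \<open>
  The same sum as in the finish rate, with the time shift \<open>t * d l\<close> in place of the rate
  \<open>q \<theta> l\<close>: if the rate of \<open>l\<close> changes at speed \<open>d l\<close>, then \<open>q \<theta> l * t\<close> changes at speed
  \<open>t * d l\<close>.
\<close>
definition flux :: "real \<Rightarrow> real \<Rightarrow> real" where
  "flux \<theta> t = (\<Sum>l\<in>A. t * d l * exp (- (q \<theta> l * t)) * (\<Prod>k\<in>A - {l}. cell_gf z j (q \<theta> k * t)))"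

definition source :: "real \<Rightarrow> real \<Rightarrow> real" where
  "source \<theta> t = u * t * (\<Sum>l\<in>A. \<Sum>m\<in>A.
     (d m - d l) * (exp (- (q \<theta> l * t)) * cell_gf' z j (q \<theta> m * t)) * other_cells \<theta> t l m)"

definition flux' :: "real \<Rightarrow> real \<Rightarrow> real" where
  "flux' \<theta> t = (\<Sum>l\<in>A. (d l - t * d l * q \<theta> l) * exp (- (q \<theta> l * t)) * (\<Prod>k\<in>A - {l}. cell_gf z j (q \<theta> k * t))
      + t * d l * exp (- (q \<theta> l * t)) * (\<Sum>m\<in>A - {l}. cell_gf' z j (q \<theta> m * t) * q \<theta> m * other_cells \<theta> t l m))"

definition rate' :: "real \<Rightarrow> real \<Rightarrow> real" where
  "rate' \<theta> t = (\<Sum>l\<in>A. (d l - t * d l * q \<theta> l) * exp (- (q \<theta> l * t)) * (\<Prod>k\<in>A - {l}. cell_gf z j (q \<theta> k * t))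
      + q \<theta> l * exp (- (q \<theta> l * t)) * (\<Sum>m\<in>A - {l}. cell_gf' z j (q \<theta> m * t) * (t * d m) * other_cells \<theta> t l m))"

lemma one_le_j: "1 \<le> j" using j by simp

lemma flux_DERIV: "((\<lambda>t. flux \<theta> t) has_field_derivative flux' \<theta> t) (at t)"
  unfolding flux_def flux'_def other_cells_def
  by (rule derivative_eq_intros has_field_derivative_prod refl one_le_j
      | simp add: algebra_simps)+

lemma rate_DERIV: "((\<lambda>\<theta>. finish_rate z j A (q \<theta>) t) has_field_derivative rate' \<theta> t) (at \<theta>)"
  unfolding finish_rate_def rate'_def other_cells_def q_def
  by (rule derivative_eq_intros has_field_derivative_prod refl one_le_j
      | simp add: algebra_simps)+

text \<open>
  The terms that differentiate an exponential agree on both sides. In the others, \<open>t\<close>-differentiation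
  gives \<open>d l * q \<theta> m\<close> where \<open>\<theta>\<close>-differentiation gives \<open>q \<theta> l * d m\<close>, and the difference of these
  is \<open>u * (d m - d l)\<close>, as the ray starts at a constant vector.
\<close>
lemma rate'_eq: "rate' \<theta> t = flux' \<theta> t + source \<theta> t"
proof -
  have "rate' \<theta> t - flux' \<theta> t = (\<Sum>l\<in>A. \<Sum>m\<in>A - {l}. exp (- (q \<theta> l * t)) * cell_gf' z j (q \<theta> m * t) * other_cells \<theta> t l m *
     (t * (q \<theta> l * d m - d l * q \<theta> m)))"
    unfolding rate'_def flux'_def sum_subtractf[symmetric] sum_distrib_left
    by (intro sum.cong refl) (simp add: sum_subtractf[symmetric] algebra_simps)
  also have "\<dots> = (\<Sum>l\<in>A. \<Sum>m\<in>A. exp (- (q \<theta> l * t)) * cell_gf' z j (q \<theta> m * t) * other_cells \<theta> t l m *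
     (t * (q \<theta> l * d m - d l * q \<theta> m)))"
    using A by (intro sum.cong refl sum.mono_neutral_left) auto
  also have "\<dots> = source \<theta> t"
    unfolding source_def sum_distrib_left
    by (intro sum.cong refl) (simp add: q_def algebra_simps)
  finally show ?thesis by simp
qed

lemma continuous_rate': "continuous_on S (\<lambda>(\<theta>, t). rate' \<theta> t)"
  unfolding rate'_def other_cells_def q_def split_beta by (intro continuous_intros)

lemma continuous_source: "continuous_on S (\<lambda>(\<theta>, t). source \<theta> t)"
  unfolding source_def other_cells_def q_def split_beta by (intro continuous_intros)

lemma continuous_source_t: "continuous_on S (\<lambda>t. source \<theta> t)"
  unfolding source_def other_cells_def q_def by (intro continuous_intros)

lemma continuous_rate: "continuous_on S (\<lambda>t. finish_rate z j A (q \<theta>) t)"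
  unfolding finish_rate_def by (intro continuous_intros)

lemma q_pos: "0 \<le> \<theta> \<Longrightarrow> \<theta> \<le> 1 \<Longrightarrow> i \<in> A \<Longrightarrow> 0 < q \<theta> i"
  using ray_pos by (simp add: q_def)

definition swap_gain :: "real \<Rightarrow> real \<Rightarrow> 'a \<Rightarrow> 'a \<Rightarrow> real" where
  "swap_gain \<theta> t l m = (d m - d l) * (exp (- (q \<theta> l * t)) * cell_gf' z j (q \<theta> m * t)
        - exp (- (q \<theta> m * t)) * cell_gf' z j (q \<theta> l * t)) * other_cells \<theta> t l m"

text \<open>
  Average the double sum with its transpose.
\<close>
lemma source_symmetrised:
  "2 * source \<theta> t = u * t * (\<Sum>l\<in>A. \<Sum>m\<in>A. swap_gain \<theta> t l m)"
proof -
  define T where "T l m = (d m - d l) * (exp (- (q \<theta> l * t)) * cell_gf' z j (q \<theta> m * t)) * other_cells \<theta> t l m" for l m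
  have other_cells_comm: "other_cells \<theta> t l m = other_cells \<theta> t m l" for l m
    unfolding other_cells_def by (simp add: Diff_insert[symmetric] insert_commute)
  have "2 * (\<Sum>l\<in>A. \<Sum>m\<in>A. T l m) = (\<Sum>l\<in>A. \<Sum>m\<in>A. T l m) + (\<Sum>l\<in>A. \<Sum>m\<in>A. T m l)"
    by (subst (3) sum.swap) simp
  also have "\<dots> = (\<Sum>l\<in>A. \<Sum>m\<in>A. swap_gain \<theta> t l m)"
    unfolding sum.distrib[symmetric] T_def swap_gain_def
    by (intro sum.cong refl) (subst other_cells_comm, simp add: algebra_simps)
  finally show ?thesis by (simp add: source_def T_def algebra_simps)
qed

lemma swap_gain_pos:
  assumes "0 < \<theta>" "\<theta> \<le> 1" "0 < t" "l \<in> A" "m \<in> A" "d l \<noteq> d m"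
  shows "0 < swap_gain \<theta> t l m"
proof -
  have R: "0 < other_cells \<theta> t l m"
    unfolding other_cells_def using assms q_pos[of \<theta>] z one_le_j by (intro prod_pos cell_gf_pos) auto
  have cross: "exp (- (q \<theta> a * t)) * cell_gf' z j (q \<theta> b * t)
        < exp (- (q \<theta> b * t)) * cell_gf' z j (q \<theta> a * t)" if "d b < d a" "b \<in> A" for a b
    using that assms q_pos[of \<theta> b] z j by (intro cell_gf'_cross) (auto simp: q_def)
  consider "d l < d m" | "d m < d l" using assms by linarith
  then show ?thesis
  proof cases
    case 1
    with R cross[OF 1 \<open>l \<in> A\<close>] show ?thesis unfolding swap_gain_def by (intro mult_pos_pos) auto
  next
    case 2
    with R cross[OF 2 \<open>m \<in> A\<close>] show ?thesis unfolding swap_gain_def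
      by (intro mult_pos_pos[OF mult_neg_neg]) auto
  qed
qed

lemma source_pos:
  assumes "0 < \<theta>" "\<theta> \<le> 1" "0 < t"
  shows "0 < source \<theta> t"
proof -
  have ge: "0 \<le> swap_gain \<theta> t l m" if "l \<in> A" "m \<in> A" for l m
    using swap_gain_pos[OF assms that] by (cases "d l = d m") (auto simp: swap_gain_def)
  obtain l m where lm: "l \<in> A" "m \<in> A" "d l \<noteq> d m" using d_neq by blast
  have "0 < (\<Sum>m\<in>A. swap_gain \<theta> t l m)"
    using A lm swap_gain_pos[OF assms lm] ge by (intro sum_pos2[of A m]) auto
  then have "0 < (\<Sum>l\<in>A. \<Sum>m\<in>A. swap_gain \<theta> t l m)"
    by (rule sum_pos2[OF A lm(1)]) (auto intro: sum_nonneg ge)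
  then have "0 < 2 * source \<theta> t" using u assms unfolding source_symmetrised by simp
  then show ?thesis by simp
qed

lemma source_0: "source \<theta> 0 = 0" by (simp add: source_def)

lemma source_nonneg: "0 < \<theta> \<Longrightarrow> \<theta> \<le> 1 \<Longrightarrow> 0 \<le> t \<Longrightarrow> 0 \<le> source \<theta> t"
  using source_pos[of \<theta> t] source_0[of \<theta>] by (cases "t = 0") auto

text \<open>
  Differentiate under the integral over the compact window \<open>{0..M}\<close> and integrate the total
  derivative.
\<close>
lemma truncated_DERIV:
  assumes "0 \<le> M"
  shows "((\<lambda>\<theta>. integral {0..M} (finish_rate z j A (q \<theta>))) has_field_derivative
           flux \<theta> M + integral {0..M} (source \<theta>)) (at \<theta>)"
proof -
  have "((\<lambda>\<theta>. integral (cbox 0 M) (finish_rate z j A (q \<theta>))) has_field_derivative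
          integral (cbox 0 M) (rate' \<theta>)) (at \<theta> within UNIV)"
    by (rule leibniz_rule_field_derivative)
      (auto intro: rate_DERIV integrable_continuous_real continuous_rate continuous_rate' has_field_derivative_at_within)
  moreover have "integral {0..M} (rate' \<theta>) = flux \<theta> M + integral {0..M} (source \<theta>)"
  proof -
    have "(flux' \<theta> has_integral (flux \<theta> M - flux \<theta> 0)) {0..M}"
      using assms by (intro fundamental_theorem_of_calculus)
        (auto intro: flux_DERIV has_field_derivative_at_within simp flip: has_real_derivative_iff_has_vector_derivative)
    then have "((\<lambda>t. flux' \<theta> t + source \<theta> t) has_integral (flux \<theta> M - flux \<theta> 0) + integral {0..M} (source \<theta>)) {0..M}"
      by (intro has_integral_add integrable_integral integrable_continuous_real continuous_source_t)
    then have "(rate' \<theta> has_integral (flux \<theta> M - flux \<theta> 0) + integral {0..M} (source \<theta>)) {0..M}"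
      unfolding rate'_eq[symmetric, abs_def] by simp
    then show ?thesis by (simp add: integral_unique flux_def)
  qed
  ultimately show ?thesis by simp
qed

text \<open>
  All rates on the ray are at least \<open>\<delta> > 0\<close>: they are convex combinations of \<open>u\<close> and the rates
  \<open>q 1 i\<close>.
\<close>
lemma flux_bound:
  obtains \<delta> C where "0 < \<delta>" "\<And>\<theta> t. 0 \<le> \<theta> \<Longrightarrow> \<theta> \<le> 1 \<Longrightarrow> 0 \<le> t \<Longrightarrow> \<bar>flux \<theta> t\<bar> \<le> C * (t * exp (- (\<delta> * t)))"
proof -
  define \<delta> where "\<delta> = Min ((\<lambda>i. min u (q 1 i)) ` A)"
  have ne: "A \<noteq> {}" using d_neq by auto
  have pos: "0 < \<delta>" unfolding \<delta>_def using A ne u q_pos[of 1] by (subst Min_gr_iff) auto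
  have le: "\<delta> \<le> q \<theta> i" if "0 \<le> \<theta>" "\<theta> \<le> 1" "i \<in> A" for \<theta> i
  proof -
    have a: "\<delta> \<le> u" "\<delta> \<le> q 1 i" unfolding \<delta>_def using Min_le[of "(\<lambda>i. min u (q 1 i)) ` A" "min u (q 1 i)"] A that by auto
    have "(1 - \<theta>) * \<delta> + \<theta> * \<delta> \<le> (1 - \<theta>) * u + \<theta> * q 1 i"
      using a that by (intro add_mono mult_left_mono) auto
    then show ?thesis by (simp add: q_def algebra_simps)
  qed
  have "\<bar>flux \<theta> t\<bar> \<le> (\<Sum>l\<in>A. \<bar>d l\<bar>) * (t * exp (- (\<delta> * t)))" if "0 \<le> \<theta>" "\<theta> \<le> 1" "0 \<le> t" for \<theta> t
  proof -
    have "\<bar>flux \<theta> t\<bar> \<le> (\<Sum>l\<in>A. \<bar>t * d l * exp (- (q \<theta> l * t)) * (\<Prod>k\<in>A - {l}. cell_gf z j (q \<theta> k * t))\<bar>)"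
      unfolding flux_def by (rule sum_abs)
    also have "\<dots> \<le> (\<Sum>l\<in>A. (t * \<bar>d l\<bar> * exp (- (\<delta> * t))) * 1)"
    proof (intro sum_mono)
      fix l assume l: "l \<in> A"
      have x: "0 \<le> q \<theta> k * t" if "k \<in> A" for k
        using q_pos[OF \<open>0 \<le> \<theta>\<close> \<open>\<theta> \<le> 1\<close> that] \<open>0 \<le> t\<close> by simp
      have "0 \<le> (\<Prod>k\<in>A - {l}. cell_gf z j (q \<theta> k * t))" "(\<Prod>k\<in>A - {l}. cell_gf z j (q \<theta> k * t)) \<le> 1"
        using z one_le_j x by (auto intro!: prod_nonneg prod_le_1 cell_gf_nonneg cell_gf_le_1)
      then show "\<bar>t * d l * exp (- (q \<theta> l * t)) * (\<Prod>k\<in>A - {l}. cell_gf z j (q \<theta> k * t))\<bar>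
          \<le> t * \<bar>d l\<bar> * exp (- (\<delta> * t)) * 1"
        unfolding abs_mult using that le[OF that(1,2) l]
        by (intro mult_mono) (auto intro!: mult_right_mono)
    qed
    also have "\<dots> = (\<Sum>l\<in>A. \<bar>d l\<bar>) * (t * exp (- (\<delta> * t)))" by (simp add: sum_distrib_left sum_distrib_right algebra_simps)
    finally show ?thesis .
  qed
  with pos show ?thesis using that by blast
qed

text \<open>
  The mean value theorem on a window \<open>{0..n}\<close>, followed by \<open>n \<rightarrow> \<infinity>\<close>. The interval \<open>{1..2}\<close> stands for
  any part of the window that stays away from \<open>t = 0\<close>, where the source vanishes.
\<close>
lemma limit_increment:
  assumes lim: "\<And>\<theta>. 0 \<le> \<theta> \<Longrightarrow> \<theta> \<le> 1 \<Longrightarrow> (\<lambda>n. integral {0..real n} (finish_rate z j A (q \<theta>))) \<longlonglongrightarrow> I \<theta>"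
    and ab: "0 \<le> a" "a < b" "b \<le> 1"
    and \<kappa>: "\<And>\<theta>. a < \<theta> \<Longrightarrow> \<theta> < b \<Longrightarrow> \<kappa> \<le> integral {1..2} (source \<theta>)"
  shows "\<kappa> * (b - a) \<le> I b - I a"
proof -
  obtain \<delta> C where \<delta>: "0 < \<delta>" and C: "\<And>\<theta> t. 0 \<le> \<theta> \<Longrightarrow> \<theta> \<le> 1 \<Longrightarrow> 0 \<le> t \<Longrightarrow> \<bar>flux \<theta> t\<bar> \<le> C * (t * exp (- (\<delta> * t)))"
    using flux_bound by blast
  define H where "H n \<theta> = integral {0..real n} (finish_rate z j A (q \<theta>))" for n \<theta>
  have "(\<kappa> - C * (real n * exp (- (\<delta> * real n)))) * (b - a) \<le> H n b - H n a" if n: "2 \<le> n" for n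
  proof -
    obtain \<theta> where \<theta>: "a < \<theta>" "\<theta> < b"
      "H n b - H n a = (b - a) * (flux \<theta> (real n) + integral {0..real n} (source \<theta>))"
      using MVT2[OF ab(2), of "H n" "\<lambda>\<theta>. flux \<theta> (real n) + integral {0..real n} (source \<theta>)"]
        truncated_DERIV[of "real n"] unfolding H_def by auto
    have "integral {1..2} (source \<theta>) \<le> integral {0..real n} (source \<theta>)"
      using n \<theta> ab by (intro integral_subset_le integrable_continuous_real continuous_source_t)
        (auto intro!: source_nonneg)
    then have "\<kappa> - C * (real n * exp (- (\<delta> * real n))) \<le> flux \<theta> (real n) + integral {0..real n} (source \<theta>)"
      using \<kappa>[OF \<theta>(1,2)] C[of \<theta> "real n"] \<theta> ab by (simp add: abs_le_iff)
    then show ?thesis unfolding \<theta>(3) using ab by (simp add: mult.commute mult_left_mono)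
  qed
  moreover have "(\<lambda>n. (\<kappa> - C * (real n * exp (- (\<delta> * real n)))) * (b - a)) \<longlonglongrightarrow> (\<kappa> - C * 0) * (b - a)"
  proof -
    have "(\<lambda>n. real n * exp (- (\<delta> * real n))) \<longlonglongrightarrow> 0"
      using \<delta> by real_asymp
    then show ?thesis by (intro tendsto_intros)
  qed
  moreover have "(\<lambda>n. H n b - H n a) \<longlonglongrightarrow> I b - I a"
    unfolding H_def using ab by (intro tendsto_diff lim) auto
  ultimately show ?thesis
    by (intro LIMSEQ_le[of _ "\<kappa> * (b - a)" _ "I b - I a"]) auto
qed

text \<open>
  At \<open>\<theta> = 0\<close> the rates are equal and the source vanishes, so it has no positive lower bound on an
  interval starting there. Hence the interval is halved: the limit does not decrease on the first
  half, and on the second half the source is bounded below by compactness.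
\<close>
lemma limit_strict_mono:
  assumes lim: "\<And>\<theta>. 0 \<le> \<theta> \<Longrightarrow> \<theta> \<le> 1 \<Longrightarrow> (\<lambda>n. integral {0..real n} (finish_rate z j A (q \<theta>))) \<longlonglongrightarrow> I \<theta>"
  shows "strict_mono_on {0..1} I"
proof (rule strict_mono_onI)
  fix a b :: real assume ab: "a \<in> {0..1}" "b \<in> {0..1}" "a < b"
  define c where "c = (a + b) / 2"
  have c: "a < c" "c < b" "0 < c" using ab by (auto simp: c_def)
  have int_nonneg: "0 \<le> integral {1..2} (source \<theta>)" if "0 < \<theta>" "\<theta> \<le> 1" for \<theta>
    using that by (intro integral_nonneg integrable_continuous_real continuous_source_t) (auto intro!: source_nonneg)
  have 1: "0 * (c - a) \<le> I c - I a"
    using ab c by (intro limit_increment lim int_nonneg) auto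
  obtain \<theta>0 t0 where m: "\<theta>0 \<in> {c..b}" "t0 \<in> {1..2}"
      and min: "\<And>\<theta> t. \<theta> \<in> {c..b} \<Longrightarrow> t \<in> {1..2} \<Longrightarrow> source \<theta>0 t0 \<le> source \<theta> t"
    using continuous_attains_inf[of "{c..b} \<times> {1..2}" "\<lambda>(\<theta>, t). source \<theta> t"] c
    by (force intro: compact_Times continuous_source)
  define \<kappa> where "\<kappa> = source \<theta>0 t0"
  have "0 < \<kappa>" unfolding \<kappa>_def using m c ab by (intro source_pos) auto
  have "\<kappa> \<le> integral {1..2} (source \<theta>)" if "\<theta> \<in> {c..b}" for \<theta>
  proof -
    have "integral {1..2} (\<lambda>t::real. \<kappa>) \<le> integral {1..2} (source \<theta>)"
      using min that unfolding \<kappa>_def by (intro integral_le integrable_continuous_real continuous_source_t) auto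
    then show ?thesis by simp
  qed
  then have "\<kappa> * (b - c) \<le> I b - I c"
    using ab c by (intro limit_increment lim) auto
  moreover have "0 < \<kappa> * (b - c)" using \<open>0 < \<kappa>\<close> c by simp
  ultimately show "I a < I b" using 1 by simp
qed

end

lemma pgf_strict_mono_on_ray:
  fixes z :: real
  assumes "N \<ge> 2" and "j \<ge> 2"
    and p: "\<And>i. i \<in> {1..N} \<Longrightarrow> p i > 0" "(\<Sum>i=1..N. p i) = 1"
    and ne: "\<exists>i\<in>{1..N}. p i \<noteq> unif N i" and z: "0 < z" "z < 1"
  shows "strict_mono_on {0..1} (\<lambda>\<theta>::real. LINT \<omega>|draws N (ray N p \<theta>). z ^ U N j \<omega>)"
proof -
  define u where "u = 1 / real N"
  define d where "d i = p i - u" for i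
  have u: "0 < u" "(\<Sum>i=1..N. u) = 1" using assms(1) by (auto simp: u_def)
  have ray: "ray N p \<theta> = (\<lambda>i. u + \<theta> * d i)" for \<theta> by (simp add: ray_def unif_def u_def d_def)
  have pos: "0 < u + \<theta> * d i" if "0 \<le> \<theta>" "\<theta> \<le> 1" "i \<in> {1..N}" for \<theta> i
  proof -
    have "0 < (1 - \<theta>) * u + \<theta> * p i"
      using that p(1)[of i] u by (cases "\<theta> = 0") (auto intro: add_nonneg_pos)
    then show ?thesis by (simp add: d_def algebra_simps)
  qed
  have d_sum: "(\<Sum>i=1..N. d i) = 0"
    unfolding d_def sum_subtractf using p(2) u(2) by linarith
  have sum: "(\<Sum>i=1..N. u + \<theta> * d i) = 1" for \<theta>
    unfolding sum.distrib sum_distrib_left[symmetric] d_sum u(2) by simp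
  have d_neq: "\<exists>i\<in>{1..N}. \<exists>l\<in>{1..N}. d i \<noteq> d l"
  proof (rule ccontr)
    assume "\<not> ?thesis"
    then have eq: "d i = d l" if "i \<in> {1..N}" "l \<in> {1..N}" for i l using that by blast
    obtain i where i: "i \<in> {1..N}" "d i \<noteq> 0" using ne by (auto simp: d_def unif_def u_def)
    (* a constant direction with sum 0 vanishes *)
    have "(\<Sum>l=1..N. d l) = (\<Sum>l=1..N. d i)" using i(1) by (intro sum.cong refl eq)
    then have "real N * d i = 0" using d_sum by simp
    with i(2) assms(1) show False by simp
  qed
  interpret ray_flow z j "{1..N}" u d
    using z assms(2) u pos d_neq by unfold_locales auto
  have "strict_mono_on {0..1} (\<lambda>\<theta>::real. (LINT \<omega>|draws N (ray N p \<theta>). z ^ U N j \<omega>) / z)"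
  proof (rule limit_strict_mono)
    show "(\<lambda>n. integral {0..real n} (finish_rate z j {1..N} (q \<theta>))) \<longlonglongrightarrow>
        (LINT \<omega>|draws N (ray N p \<theta>). z ^ U N j \<omega>) / z" if "0 \<le> \<theta>" "\<theta> \<le> 1" for \<theta>
      using truncated_finish_rate_LIMSEQ[of N j z "\<lambda>i. u + \<theta> * d i"] assms(1,2) z pos[OF that] sum
      by (simp add: ray q_def[abs_def])
  qed
  then show ?thesis using z by (simp add: strict_mono_on_def divide_less_cancel)
qed

theorem theorem2p2:
  fixes N j :: nat and p :: "nat \<Rightarrow> real"
  assumes "N \<ge> 2" and "j \<ge> 2"
    and "\<And>i. i \<in> {1..N} \<Longrightarrow> p i > 0"
    and "(\<Sum>i=1..N. p i) = 1"
    and "\<exists>i\<in>{1..N}. p i \<noteq> unif N i"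
  shows "(\<forall>z. 0 < z \<and> z < 1 \<longrightarrow>
            strict_mono_on {0..1} (\<lambda>\<theta>::real. LINT \<omega>|draws N (ray N p \<theta>). (z::real) ^ U N j \<omega>))
       \<and> (\<forall>s>0. strict_mono_on {0..1}
            (\<lambda>\<theta>::real. LINT \<omega>|draws N (ray N p \<theta>). exp (- s * real (U N j \<omega>))))
       \<and> (\<forall>\<theta>\<^sub>1 \<theta>\<^sub>2. 0 \<le> \<theta>\<^sub>1 \<and> \<theta>\<^sub>1 < \<theta>\<^sub>2 \<and> \<theta>\<^sub>2 \<le> 1 \<longrightarrow>
            laplace_le (draws N (ray N p \<theta>\<^sub>2)) (\<lambda>\<omega>. real (U N j \<omega>))
                       (draws N (ray N p \<theta>\<^sub>1)) (\<lambda>\<omega>. real (U N j \<omega>)))"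
proof -
  have pgf: "strict_mono_on {0..1} (\<lambda>\<theta>::real. LINT \<omega>|draws N (ray N p \<theta>). z ^ U N j \<omega>)"
    if "0 < z" "z < 1" for z :: real
    by (rule pgf_strict_mono_on_ray[OF assms(1,2) _ assms(4,5) that]) (rule assms(3))
  have exp_eq: "exp (- s * real n) = exp (- s) ^ n" for s :: real and n
    by (simp add: exp_of_nat_mult[symmetric] mult.commute)
  have lap: "strict_mono_on {0..1} (\<lambda>\<theta>::real. LINT \<omega>|draws N (ray N p \<theta>). exp (- s * real (U N j \<omega>)))"
    if "0 < s" for s
    unfolding exp_eq using that by (intro pgf) auto
  have "laplace_le (draws N (ray N p \<theta>\<^sub>2)) (\<lambda>\<omega>. real (U N j \<omega>))
      (draws N (ray N p \<theta>\<^sub>1)) (\<lambda>\<omega>. real (U N j \<omega>))"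
    if "0 \<le> \<theta>\<^sub>1" "\<theta>\<^sub>1 < \<theta>\<^sub>2" "\<theta>\<^sub>2 \<le> 1" for \<theta>\<^sub>1 \<theta>\<^sub>2
    unfolding laplace_le_def
    using strict_mono_onD[OF lap] that by (auto intro!: less_imp_le)
  with pgf lap show ?thesis by blast
qed

end
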